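(* Let $\tau$ be a nonzero cardinal number, $p\in[1,\infty]$, and let $\varphi:\tau\to\tau$ be a map with $\sigma_\varphi(\ell^p(\tau))\subseteq\ell^p(\tau)$. Then: (a) $\sigma_\varphi\restriction_{\ell^p(\tau)}:\ell^p(\tau)\to\ell^p(\tau)$ is a generalized derivation if and only if $\varphi=id_\tau$; (b) $\sigma_\varphi\restriction_{\ell^p(\tau)}:\ell^p(\tau)\to\ell^p(\tau)$ is a generalized Jordan derivation if and only if $\varphi=id_\tau$; (c) $\sigma_\varphi\restriction_{\ell^p(\tau)}:\ell^p(\tau)\to\ell^p(\tau)$ is a generalized Jordan triple derivation if and only if $\varphi=id_\tau$.
   Context: For a nonzero cardinal $\tau$ (regarded as the set of ordinals $\alpha<\tau$) and $p\in[1,\infty]$, $\ell^p(\tau)$ is the set of $x=(x_\alpha)_{\alpha<\tau}\in\mathbb{C}^\tau$ with $\|x\|_p<\infty$, where $\|x\|_p=(\sum_{\alpha<\tau}|x_\alpha|^p)^{1/p}$ for $p<\infty$ and $\|x\|_\infty=\sup_{\alpha<\tau}|x_\alpha|$. With the norm $\|\cdot\|_p$, pointwise sum and pointwise product it is a Banach algebra. For $\varphi:\tau\to\tau$, the generalized shift is $\sigma_\varphi:\mathbb{C}^\tau\to\mathbb{C}^\tau$, $(x_\alpha)_{\alpha<\tau}\mapsto(x_{\varphi(\alpha)})_{\alpha<\tau}$; $id_\tau$ is the identity map of $\tau$. On a Banach algebra $\mathcal{A}$, a linear mapping $d:\mathcal{A}\to\mathcal{A}$ is a derivation if $d(ab)=d(a)b+ad(b)$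 for all $a,b\in\mathcal{A}$, and a Jordan triple derivation if $d(aba)=d(a)ba+ad(b)a+abd(a)$ for all $a,b\in\mathcal{A}$. A linear mapping $D:\mathcal{A}\to\mathcal{A}$ is: a generalized derivation if there exists a derivation $d:\mathcal{A}\to\mathcal{A}$ with $D(ab)=D(a)b+ad(b)$ for all $a,b\in\mathcal{A}$; a generalized Jordan derivation if there exists a derivation $d:\mathcal{A}\to\mathcal{A}$ with $D(a^2)=D(a)a+ad(a)$ for all $a\in\mathcal{A}$; a generalized Jordan triple derivation if there exists a Jordan triple derivation $d:\mathcal{A}\to\mathcal{A}$ with $D(aba)=D(a)ba+ad(b)a+abd(a)$ for all $a,b\in\mathcal{A}$. *)

theory Defs
  imports "HOL-Analysis.Analysis" "HOL-Library.Function_Algebras"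
begin

text \<open>
  A nonzero cardinal \<open>\<tau>\<close> is represented by an arbitrary type \<open>'i\<close> (types are nonempty, and
  nothing below uses an ordering of the indices), and \<open>\<complex>\<^sup>\<tau>\<close> by the type \<open>'i \<Rightarrow> complex\<close>, whose
  \<open>+\<close>, \<open>*\<close> and \<open>0\<close> are the pointwise ones of \<open>HOL-Library.Function_Algebras\<close>.
  The exponent is \<open>p :: ennreal\<close> with \<open>1 \<le> p\<close>, so \<open>p = \<infinity>\<close> is included.
\<close>

definition lp_norm :: "ennreal \<Rightarrow> ('i \<Rightarrow> complex) \<Rightarrow> ennreal" where
  "lp_norm p x =
     (if p = \<infinity> then (SUP i. ennreal (cmod (x i)))
      else let S = (\<Sum>\<^sub>\<infinity>i. ennreal (cmod (x i) powr enn2real p))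
           in if S = \<infinity> then \<infinity> else ennreal (enn2real S powr (1 / enn2real p)))"

definition lp_space :: "ennreal \<Rightarrow> ('i \<Rightarrow> complex) set" where
  "lp_space p = {x. lp_norm p x < \<infinity>}"

definition scale_fun :: "complex \<Rightarrow> ('i \<Rightarrow> complex) \<Rightarrow> ('i \<Rightarrow> complex)" where
  "scale_fun c x = (\<lambda>i. c * x i)"

definition gen_shift :: "('i \<Rightarrow> 'i) \<Rightarrow> ('i \<Rightarrow> complex) \<Rightarrow> ('i \<Rightarrow> complex)" where
  "gen_shift \<phi> x = (\<lambda>i. x (\<phi> i))"

text \<open>
  In the following, the algebra is the subset \<open>A\<close> of an ambient ring, closed under the ring
  operations and the complex scalar multiplication \<open>s\<close>. The values of maps outside
  \<open>A\<close> are irrelevant.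
\<close>

definition linear_map_on ::
  "(complex \<Rightarrow> 'b::ring \<Rightarrow> 'b) \<Rightarrow> 'b set \<Rightarrow> ('b \<Rightarrow> 'b) \<Rightarrow> bool" where
  "linear_map_on s A f \<longleftrightarrow>
     f \<in> A \<rightarrow> A \<and>
     (\<forall>a\<in>A. \<forall>b\<in>A. f (a + b) = f a + f b) \<and>
     (\<forall>c. \<forall>a\<in>A. f (s c a) = s c (f a))"

definition derivation_on ::
  "(complex \<Rightarrow> 'b::ring \<Rightarrow> 'b) \<Rightarrow> 'b set \<Rightarrow> ('b \<Rightarrow> 'b) \<Rightarrow> bool" where
  "derivation_on s A d \<longleftrightarrow>
     linear_map_on s A d \<and> (\<forall>a\<in>A. \<forall>b\<in>A. d (a * b) = d a * b + a * d b)"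

definition jordan_triple_derivation_on ::
  "(complex \<Rightarrow> 'b::ring \<Rightarrow> 'b) \<Rightarrow> 'b set \<Rightarrow> ('b \<Rightarrow> 'b) \<Rightarrow> bool" where
  "jordan_triple_derivation_on s A d \<longleftrightarrow>
     linear_map_on s A d \<and>
     (\<forall>a\<in>A. \<forall>b\<in>A. d (a * b * a) = d a * b * a + a * d b * a + a * b * d a)"

definition generalized_derivation_on ::
  "(complex \<Rightarrow> 'b::ring \<Rightarrow> 'b) \<Rightarrow> 'b set \<Rightarrow> ('b \<Rightarrow> 'b) \<Rightarrow> bool" where
  "generalized_derivation_on s A D \<longleftrightarrow>
     linear_map_on s A D \<and>
     (\<exists>d. derivation_on s A d \<and> (\<forall>a\<in>A. \<forall>b\<in>A. D (a * b) = D a * b + a * d b))"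

definition generalized_jordan_derivation_on ::
  "(complex \<Rightarrow> 'b::ring \<Rightarrow> 'b) \<Rightarrow> 'b set \<Rightarrow> ('b \<Rightarrow> 'b) \<Rightarrow> bool" where
  "generalized_jordan_derivation_on s A D \<longleftrightarrow>
     linear_map_on s A D \<and>
     (\<exists>d. derivation_on s A d \<and> (\<forall>a\<in>A. D (a * a) = D a * a + a * d a))"

definition generalized_jordan_triple_derivation_on ::
  "(complex \<Rightarrow> 'b::ring \<Rightarrow> 'b) \<Rightarrow> 'b set \<Rightarrow> ('b \<Rightarrow> 'b) \<Rightarrow> bool" where
  "generalized_jordan_triple_derivation_on s A D \<longleftrightarrow>
     linear_map_on s A D \<and>
     (\<exists>d. jordan_triple_derivation_on s A d \<and>
        (\<forall>a\<in>A. \<forall>b\<in>A. D (a * b * a) = D a * b * a + a * d b * a + a * b * d a))"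

end

theory Submission
  imports Defs
begin

text \<open>
  If \<open>d\<close> is a derivation or a Jordan triple derivation and \<open>e\<close> is an idempotent, then \<open>d e = k e (d e)\<close>
  with \<open>k = 2\<close> or \<open>k = 3\<close>; as \<open>e\<close> only takes the values \<open>0\<close> and \<open>1\<close>, this forces \<open>d e = 0\<close>. Hence a
  generalized derivation \<open>D\<close> of any of the three kinds satisfies \<open>D e = (D e) e\<close>. For
  \<open>D = \<sigma>\<^sub>\<phi>\<close> and \<open>e\<close> the unit vector at \<open>j\<close> this says that \<open>\<phi> i = j\<close> implies \<open>i = j\<close>. Conversely,
  the identity map is a generalized derivation of each kind, with \<open>d = 0\<close>.
\<close>

lemma lp_space_infinity: "x \<in> lp_space \<infinity> \<longleftrightarrow> (\<exists>B. \<forall>i. cmod (x i) \<le> B)"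
proof
  assume "x \<in> lp_space \<infinity>"
  then have fin: "(SUP i. ennreal (cmod (x i))) < \<infinity>"
    by (simp add: lp_space_def lp_norm_def)
  have "cmod (x i) \<le> enn2real (SUP i. ennreal (cmod (x i)))" for i
  proof -
    have "ennreal (cmod (x i)) \<le> (SUP i. ennreal (cmod (x i)))"
      by (rule SUP_upper) simp
    with fin show ?thesis
      by (metis enn2real_ennreal enn2real_mono infinity_ennreal_def norm_ge_zero)
  qed
  then show "\<exists>B. \<forall>i. cmod (x i) \<le> B" by blast
next
  assume "\<exists>B. \<forall>i. cmod (x i) \<le> B"
  then obtain B where "\<And>i. cmod (x i) \<le> B" by blast
  then have "(SUP i. ennreal (cmod (x i))) \<le> ennreal B"
    by (intro SUP_least ennreal_leI)
  then show "x \<in> lp_space \<infinity>"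
    by (auto simp: lp_space_def lp_norm_def intro: le_less_trans)
qed

lemma lp_space_finite:
  assumes "p \<noteq> \<infinity>"
  shows "x \<in> lp_space p \<longleftrightarrow> (\<Sum>\<^sub>\<infinity>i. ennreal (cmod (x i) powr enn2real p)) < \<infinity>"
  using assms by (auto simp: lp_space_def lp_norm_def Let_def top.not_eq_extremum)

text \<open>For finite \<open>p\<close>, a single term is a sum over \<open>{i}\<close> and so at
  most the whole sum \<open>S\<close>; taking \<open>r\<close>-th roots bounds every coordinate
  uniformly.\<close>

lemma lp_space_bounded:
  assumes "1 \<le> p" and "x \<in> lp_space p"
  obtains B where "\<And>i. cmod (x i) \<le> B"
proof (cases "p = \<infinity>")
  case True
  then show ?thesis using assms lp_space_infinity that by blast
next
  case False
  define r where "r = enn2real p"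
  have r: "1 \<le> r"
    using assms False enn2real_mono[of 1 p] by (simp add: r_def top.not_eq_extremum)
  define S where "S = (\<Sum>\<^sub>\<infinity>i. ennreal (cmod (x i) powr r))"
  have fin: "S < \<infinity>" using assms False by (simp add: lp_space_finite S_def r_def)
  have "cmod (x i) \<le> enn2real S powr (1 / r)" for i
  proof -
    have "(\<Sum>\<^sub>\<infinity>i\<in>{i}. ennreal (cmod (x i) powr r)) \<le> S"
      unfolding S_def by (rule infsum_mono_neutral) (auto intro: nonneg_summable_on_complete)
    with fin have "cmod (x i) powr r \<le> enn2real S"
      using enn2real_mono by fastforce
    then have "(cmod (x i) powr r) powr (1 / r) \<le> enn2real S powr (1 / r)"
      using r by (intro powr_mono2) auto
    then show ?thesis using r by (simp add: powr_powr)
  qed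
  then show ?thesis using that by blast
qed

text \<open>A common criterion for all closure properties: sums use \<open>c = 1\<close>; scalar
  multiples and products take both dominating vectors equal.\<close>

lemma lp_space_dominated:
  assumes p: "1 \<le> p" and x: "x \<in> lp_space p" and y: "y \<in> lp_space p"
    and c: "0 \<le> c" and z: "\<And>i. cmod (z i) \<le> c * (cmod (x i) + cmod (y i))"
  shows "z \<in> lp_space p"
proof (cases "p = \<infinity>")
  case True
  obtain B C where "\<And>i. cmod (x i) \<le> B" "\<And>i. cmod (y i) \<le> C"
    using lp_space_bounded[OF p] x y by metis
  then have "cmod (z i) \<le> c * (B + C)" for i
    using order_trans[OF z mult_left_mono[OF add_mono c]] by blast
  then show ?thesis using True lp_space_infinity by blast
next
  case False
  define r where "r = enn2real p"
  let ?N = "\<lambda>x i. ennreal (cmod (x i) powr r)"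
  have r: "0 \<le> r" by (simp add: r_def)
  have sum: "f summable_on UNIV" for f :: "'a \<Rightarrow> ennreal"
    by (rule nonneg_summable_on_complete) simp
  have bound: "?N z i \<le> ennreal ((2 * c) powr r) * (?N x i + ?N y i)" for i
  proof -
    let ?m = "max (cmod (x i)) (cmod (y i))"
    have "cmod (z i) \<le> c * (2 * ?m)"
      by (rule order_trans[OF z mult_left_mono[OF _ c]]) auto
    then have "cmod (z i) powr r \<le> (2 * c * ?m) powr r"
      using r by (intro powr_mono2) (auto simp: ac_simps)
    also have "\<dots> = (2 * c) powr r * ?m powr r"
      using c by (simp add: powr_mult le_max_iff_disj)
    also have "\<dots> \<le> (2 * c) powr r * (cmod (x i) powr r + cmod (y i) powr r)"
      by (intro mult_left_mono) (auto simp: max_def)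
    finally have "?N z i \<le> ennreal ((2 * c) powr r * (cmod (x i) powr r + cmod (y i) powr r))"
      by (rule ennreal_leI)
    then show ?thesis by (simp add: ennreal_mult)
  qed
  have "infsum (?N z) UNIV \<le> (\<Sum>\<^sub>\<infinity>i. ennreal ((2 * c) powr r) * (?N x i + ?N y i))"
    by (intro infsum_mono sum bound)
  also have "\<dots> = ennreal ((2 * c) powr r) * (\<Sum>\<^sub>\<infinity>i. ?N x i + ?N y i)"
    \<comment> \<open>The constant is pulled out of the infinite sum by viewing it as a supremum of
      finite sums.\<close>
    by (simp add: nonneg_infsum_complete SUP_mult_left_ennreal sum_distrib_left)
  also have "\<dots> = ennreal ((2 * c) powr r) * (infsum (?N x) UNIV + infsum (?N y) UNIV)"
    by (simp add: infsum_add sum)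
  also have "\<dots> < \<infinity>"
    using x y False by (simp add: lp_space_finite r_def ennreal_mult_less_top)
  finally show ?thesis using False by (simp add: lp_space_finite r_def)
qed

lemma lp_space_add:
  assumes "1 \<le> p" "x \<in> lp_space p" "y \<in> lp_space p"
  shows "x + y \<in> lp_space p"
  using assms by (rule lp_space_dominated[where c = 1]) (auto simp: norm_triangle_ineq)

lemma lp_space_scale_fun:
  assumes "1 \<le> p" "x \<in> lp_space p"
  shows "scale_fun c x \<in> lp_space p"
  using assms(1,2,2)
  by (rule lp_space_dominated[where c = "cmod c"]) (auto simp: scale_fun_def norm_mult mult_left_mono)

text \<open>One factor is bounded, so the product is dominated by a multiple of the other.\<close>

lemma lp_space_mult:
  assumes "1 \<le> p" "x \<in> lp_space p" "y \<in> lp_space p"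
  shows "x * y \<in> lp_space p"
proof -
  obtain B where B: "\<And>i. cmod (x i) \<le> B" using lp_space_bounded assms by blast
  \<comment> \<open>Any index witnesses this, since types are nonempty.\<close>
  have "0 \<le> B" using B order_trans norm_ge_zero by blast
  moreover have "cmod ((x * y) i) \<le> B * (cmod (y i) + cmod (y i))" for i
    using B \<open>0 \<le> B\<close> by (auto simp: norm_mult intro: mult_mono)
  ultimately show ?thesis using lp_space_dominated assms(1,3) by blast
qed

lemma lp_space_zero: "0 \<in> lp_space p"
  by (simp add: lp_space_def lp_norm_def)

definition unit_vec :: "'i \<Rightarrow> 'i \<Rightarrow> complex" where
  "unit_vec j = (\<lambda>i. if i = j then 1 else 0)"

lemma unit_vec_idem: "unit_vec j * unit_vec j = unit_vec j"
  by (auto simp: unit_vec_def)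

lemma lp_space_unit_vec: "unit_vec j \<in> lp_space p"
proof (cases "p = \<infinity>")
  case True
  have "cmod (unit_vec j i) \<le> 1" for i by (simp add: unit_vec_def)
  then show ?thesis using True lp_space_infinity by blast
next
  case False
  \<comment> \<open>Only the term at \<open>j\<close> survives, because \<open>0 powr r = 0\<close>
    for every \<open>r\<close>.\<close>
  have "(\<Sum>\<^sub>\<infinity>i. ennreal (cmod (unit_vec j i) powr enn2real p))
      = (\<Sum>\<^sub>\<infinity>i\<in>{j}. ennreal (cmod (unit_vec j i) powr enn2real p))"
    by (rule infsum_cong_neutral) (auto simp: unit_vec_def)
  then show ?thesis using False by (simp add: lp_space_finite)
qed

lemma derivation_on_unit_vec:
  assumes "derivation_on s A d" and "unit_vec j \<in> A"
  shows "d (unit_vec j) = 0"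
proof
  fix i
  have "d (unit_vec j) = d (unit_vec j) * unit_vec j + unit_vec j * d (unit_vec j)"
    using assms unit_vec_idem[of j] unfolding derivation_on_def by metis
  from fun_cong[OF this, of i] show "d (unit_vec j) i = 0 i"
    by (simp add: unit_vec_def split: if_splits)
qed

lemma jordan_triple_derivation_on_unit_vec:
  assumes "jordan_triple_derivation_on s A d" and "unit_vec j \<in> A"
  shows "d (unit_vec j) = 0"
proof
  fix i
  let ?e = "unit_vec j"
  have "d ?e = d ?e * ?e * ?e + ?e * d ?e * ?e + ?e * ?e * d ?e"
    using assms unit_vec_idem[of j] unfolding jordan_triple_derivation_on_def by metis
  from fun_cong[OF this, of i] show "d ?e i = 0 i"
    by (simp add: unit_vec_def split: if_splits)
qed

lemma eq_id_if_gen_shift_unit_vec: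
  assumes "\<And>j. gen_shift \<phi> (unit_vec j) = gen_shift \<phi> (unit_vec j) * unit_vec j"
  shows "\<phi> = id"
proof
  fix i
  \<comment> \<open>For \<open>j = \<phi> i\<close> the left side is 1 at coordinate
    \<open>i\<close>, so \<open>unit_vec (\<phi> i)\<close> cannot vanish there.\<close>
  from fun_cong[OF assms, of "\<phi> i" i] show "\<phi> i = id i"
    by (simp add: gen_shift_def unit_vec_def split: if_splits)
qed

text \<open>Any \<open>A\<close> containing the unit vectors will do: \<open>?e * ?e = ?e\<close>
  stays in \<open>A\<close>, where \<open>restrict\<close> agrees with the shift, and the
  \<open>d\<close> term vanishes.\<close>

lemma eq_id_if_generalized_jordan_derivation_on:
  fixes \<phi> :: "'i \<Rightarrow> 'i"
  assumes "generalized_jordan_derivation_on s A (restrict (gen_shift \<phi>) A)"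
    and e: "\<And>j :: 'i. unit_vec j \<in> A"
  shows "\<phi> = id"
proof (rule eq_id_if_gen_shift_unit_vec)
  fix j :: 'i
  let ?e = "unit_vec j" and ?D = "restrict (gen_shift \<phi>) A"
  obtain d where d: "derivation_on s A d" and D: "\<forall>a\<in>A. ?D (a * a) = ?D a * a + a * d a"
    using assms(1) unfolding generalized_jordan_derivation_on_def by blast
  show "gen_shift \<phi> ?e = gen_shift \<phi> ?e * ?e"
    using bspec[OF D e[of j]] e by (simp add: derivation_on_unit_vec[OF d e] unit_vec_idem)
qed

lemma eq_id_if_generalized_jordan_triple_derivation_on:
  fixes \<phi> :: "'i \<Rightarrow> 'i"
  assumes "generalized_jordan_triple_derivation_on s A (restrict (gen_shift \<phi>) A)"
    and e: "\<And>j :: 'i. unit_vec j \<in> A"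
  shows "\<phi> = id"
proof (rule eq_id_if_gen_shift_unit_vec)
  fix j :: 'i
  let ?e = "unit_vec j" and ?D = "restrict (gen_shift \<phi>) A"
  obtain d where d: "jordan_triple_derivation_on s A d"
    and D: "\<forall>a\<in>A. \<forall>b\<in>A. ?D (a * b * a) = ?D a * b * a + a * d b * a + a * b * d a"
    using assms(1) unfolding generalized_jordan_triple_derivation_on_def by blast
  show "gen_shift \<phi> ?e = gen_shift \<phi> ?e * ?e"
    using bspec[OF bspec[OF D e[of j]] e[of j]] e
    by (simp add: jordan_triple_derivation_on_unit_vec[OF d e] unit_vec_idem mult.assoc)
qed

text \<open>The case \<open>b = a\<close>; it reduces the forward direction of (a) to that of
  (b).\<close>

lemma generalized_jordan_derivation_on_if_generalized_derivation_on:
  "generalized_derivation_on s A D \<Longrightarrow> generalized_jordan_derivation_on s A D"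
  unfolding generalized_derivation_on_def generalized_jordan_derivation_on_def by blast

lemma
  assumes p: "1 \<le> p"
  shows generalized_derivation_on_id:
      "generalized_derivation_on scale_fun (lp_space p)
        (restrict (gen_shift (id :: 'i \<Rightarrow> 'i)) (lp_space p))"
    and generalized_jordan_triple_derivation_on_id:
      "generalized_jordan_triple_derivation_on scale_fun (lp_space p)
        (restrict (gen_shift (id :: 'i \<Rightarrow> 'i)) (lp_space p))"
proof -
  let ?A = "lp_space p :: ('i \<Rightarrow> complex) set"
  let ?D = "restrict (gen_shift id) ?A"
  \<comment> \<open>Closure matters because \<open>restrict\<close> is \<open>undefined\<close>
    outside \<open>?A\<close>: evaluating \<open>?D\<close> at a sum, multiple or product requires
    membership.\<close>
  note closed = lp_space_add[OF p] lp_space_scale_fun[OF p] lp_space_mult[OF p] lp_space_zero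
  have id: "gen_shift id x = x" for x :: "'i \<Rightarrow> complex"
    by (simp add: gen_shift_def)
  have "scale_fun c (0 :: 'i \<Rightarrow> complex) = 0" for c :: complex
    by (auto simp: scale_fun_def)
  then have lin0: "linear_map_on scale_fun ?A (\<lambda>_. 0 :: 'i \<Rightarrow> complex)"
    by (simp add: linear_map_on_def closed)
  have lin: "linear_map_on scale_fun ?A ?D"
    by (auto simp: linear_map_on_def closed id)
  have "derivation_on scale_fun ?A (\<lambda>_. 0)"
    using lin0 by (simp add: derivation_on_def)
  with lin show "generalized_derivation_on scale_fun ?A ?D"
    unfolding generalized_derivation_on_def by (auto simp: closed id intro!: exI[of _ "\<lambda>_. 0"])
  have "jordan_triple_derivation_on scale_fun ?A (\<lambda>_. 0)"
    using lin0 by (simp add: jordan_triple_derivation_on_def)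
  with lin show "generalized_jordan_triple_derivation_on scale_fun ?A ?D"
    unfolding generalized_jordan_triple_derivation_on_def
    by (auto simp: closed id intro!: exI[of _ "\<lambda>_. 0"])
qed

theorem theorem3p2:
  fixes p :: ennreal and \<phi> :: "'i \<Rightarrow> 'i"
  assumes "1 \<le> p"
    and "gen_shift \<phi> ` lp_space p \<subseteq> lp_space p"
  shows "(generalized_derivation_on scale_fun (lp_space p)
            (restrict (gen_shift \<phi>) (lp_space p)) \<longleftrightarrow> \<phi> = id) \<and>
         (generalized_jordan_derivation_on scale_fun (lp_space p)
            (restrict (gen_shift \<phi>) (lp_space p)) \<longleftrightarrow> \<phi> = id) \<and>
         (generalized_jordan_triple_derivation_on scale_fun (lp_space p)
            (restrict (gen_shift \<phi>) (lp_space p)) \<longleftrightarrow> \<phi> = id)"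
  \<comment> \<open>(a) and (b) follow from the cycle (a), (b), \<open>\<phi> = id\<close>, (a); the
    two directions of (c) are proved separately.\<close>
  using generalized_derivation_on_id[OF assms(1)]
    generalized_jordan_triple_derivation_on_id[OF assms(1)]
    generalized_jordan_derivation_on_if_generalized_derivation_on
    eq_id_if_generalized_jordan_derivation_on[OF _ lp_space_unit_vec]
    eq_id_if_generalized_jordan_triple_derivation_on[OF _ lp_space_unit_vec]
  by metis

end
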